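(* Let $n\ge 2$ and $\sigma\in CK_n$. There are $n$ distinct permutations $\sigma'\in CK_{n-1}$ such that $\sigma'\prec\sigma$ if and only if $cbr(\sigma)>3$.
   Context: $S_n$ is the set of permutations of $[n]=\{1,\dots,n\}$, written in one-line notation $\sigma=[\sigma_1,\dots,\sigma_n]$. For $n\ge 2$, $CK_n$ is the set of cylindrical king permutations of order $n$: those $\sigma\in S_n$ with $|\sigma_{i+1}-\sigma_i|>1$ for all $1\le i\le n-1$ and $|\sigma_1-\sigma_n|>1$. By convention $CK_1=S_1$ (one has $CK_2=CK_3=CK_4=\emptyset$). For $\sigma\in S_n$, $\pi\in S_k$ with $k<n$, write $\pi\prec\sigma$ if the one-line notation of $\sigma$ has a (not necessarily consecutive) subsequence order-isomorphic to $\pi$. For $\sigma\in S_n$ and $1\le i<j\le n$ let $||j-i||=\min(j-i,\;n-j+i)$, and let the cyclic Manhattan distance be $cd_\sigma(i,j)=cd_\sigma(j,i)=|\sigma_j-\sigma_i|+||j-i||$. The cyclic breadth of $\sigma$ (for $n\ge 2$) is $cbr(\sigma)=\min_{i,j\in[n],\,i\ne j} cd_\sigma(i,j)$. *)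

theory Defs
  imports "HOL-Combinatorics.Permutations"
begin

text \<open>
  Permutations of \<open>[n]\<close> are functions \<open>\<sigma>\<close> with \<open>\<sigma> permutes {1..n}\<close>; the one-line notation is
  \<open>[\<sigma> 1, \<dots>, \<sigma> n]\<close>. As such functions are the identity outside \<open>{1..n}\<close>, distinct functions
  are distinct permutations. They do not determine \<open>n\<close>, so orders are passed explicitly.
\<close>

definition Sym :: "nat \<Rightarrow> (nat \<Rightarrow> nat) set" where
  "Sym n = {\<sigma>. \<sigma> permutes {1..n}}"

definition CK :: "nat \<Rightarrow> (nat \<Rightarrow> nat) set" where
  "CK n = (if n = 1 then Sym 1 else
     {\<sigma> \<in> Sym n.
        (\<forall>i\<in>{1..n - 1}. \<bar>int (\<sigma> (i + 1)) - int (\<sigma> i)\<bar> > 1)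
        \<and> \<bar>int (\<sigma> 1) - int (\<sigma> n)\<bar> > 1})"

text \<open>
  The permutation \<open>\<pi>\<close> of order \<open>k\<close> is contained as a pattern in the permutation \<open>\<sigma>\<close> of order \<open>n\<close>:
  \<open>f\<close> lists the positions of a subsequence of \<open>\<sigma>\<close> order-isomorphic to \<open>\<pi>\<close>.
\<close>

definition pattern_in :: "nat \<Rightarrow> (nat \<Rightarrow> nat) \<Rightarrow> nat \<Rightarrow> (nat \<Rightarrow> nat) \<Rightarrow> bool" where
  "pattern_in k \<pi> n \<sigma> \<longleftrightarrow>
     (\<exists>f. strict_mono_on {1..k} f \<and> f ` {1..k} \<subseteq> {1..n} \<and>
        (\<forall>i\<in>{1..k}. \<forall>j\<in>{1..k}. \<pi> i < \<pi> j \<longleftrightarrow> \<sigma> (f i) < \<sigma> (f j)))"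

definition cyc_dist :: "nat \<Rightarrow> nat \<Rightarrow> nat \<Rightarrow> int" where
  "cyc_dist n i j = min \<bar>int j - int i\<bar> (int n - \<bar>int j - int i\<bar>)"

definition cd :: "nat \<Rightarrow> (nat \<Rightarrow> nat) \<Rightarrow> nat \<Rightarrow> nat \<Rightarrow> int" where
  "cd n \<sigma> i j = \<bar>int (\<sigma> j) - int (\<sigma> i)\<bar> + cyc_dist n i j"

text \<open>Meaningful for \<open>n \<ge> 2\<close> only: otherwise the set of pairs is empty.\<close>

definition cbr :: "nat \<Rightarrow> (nat \<Rightarrow> nat) \<Rightarrow> int" where
  "cbr n \<sigma> = Min {cd n \<sigma> i j | i j. i \<in> {1..n} \<and> j \<in> {1..n} \<and> i \<noteq> j}"

end

theory Submission
  imports Defs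
begin

text \<open>
  A pattern of order \<open>n - 1\<close> in \<open>\<sigma>\<close> arises by deleting one entry of \<open>\<sigma>\<close>, say the one at position
  \<open>p\<close>, and renumbering positions and values. If \<open>p < q\<close> and the deletions at \<open>p\<close> and \<open>q\<close> agree,
  then comparing their entries at position \<open>p\<close> gives \<open>\<bar>\<sigma> (p + 1) - \<sigma> p\<bar> \<le> 1\<close>; so for a king
  permutation the \<open>n\<close> deletions are pairwise distinct (\<open>inj_on_delete\<close>), and the count is \<open>n\<close>
  exactly if every deletion is again a cylindrical king permutation.

  A deletion at \<open>p\<close> can fail to be one in two ways only. It may delete the value strictly between
  two cyclically adjacent entries of \<open>\<sigma>\<close> whose values differ by \<open>2\<close>, or it may make adjacent two
  entries whose values differ by \<open>1\<close> by removing the single position between them. In both cases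
  the two entries have cyclic distance \<open>3\<close>, that is \<open>2 + 1\<close> or \<open>1 + 2\<close>. The remaining possibility,
  that \<open>p\<close> is between its neighbours both in position and in value, and these are \<open>2\<close> apart in
  value, would make \<open>\<sigma> p\<close> differ by \<open>1\<close> from a neighbour. Conversely, \<open>3\<close> is the least cyclic
  distance that a cylindrical king permutation allows, and a pair attaining it splits as \<open>2 + 1\<close>
  or \<open>1 + 2\<close>, so it is destroyed by one of the two kinds of deletion (\<open>all_deletions_CK_iff\<close>).
\<close>

section \<open>Removing a number from an interval\<close>

text \<open>
  The order isomorphism from the naturals onto the naturals without \<open>p\<close>, and its inverse. Both
  positions and values are renumbered with them.
\<close>

definition skip :: "nat \<Rightarrow> nat \<Rightarrow> nat" where
  "skip p i = (if i < p then i else i + 1)"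

definition squeeze :: "nat \<Rightarrow> nat \<Rightarrow> nat" where
  "squeeze v x = (if x > v then x - 1 else x)"

lemma skip_neq: "skip p i \<noteq> p"
  by (simp add: skip_def)

lemma skip_less_iff: "skip p i < skip p j \<longleftrightarrow> i < j"
  by (auto simp: skip_def)

lemma skip_squeeze: "x \<noteq> p \<Longrightarrow> skip p (squeeze p x) = x"
  by (auto simp: skip_def squeeze_def)

lemma skip_in: "\<lbrakk>p \<in> {1..n}; i \<in> {1..n - 1}\<rbrakk> \<Longrightarrow> skip p i \<in> {1..n}"
  by (auto simp: skip_def)

lemma squeeze_in: "\<lbrakk>v \<in> {1..n}; x \<in> {1..n}; x \<noteq> v\<rbrakk> \<Longrightarrow> squeeze v x \<in> {1..n - 1}"
  by (auto simp: squeeze_def)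

lemma squeeze_less_iff: "\<lbrakk>x \<noteq> v; y \<noteq> v\<rbrakk> \<Longrightarrow> squeeze v x < squeeze v y \<longleftrightarrow> x < y"
  by (auto simp: squeeze_def)

text \<open>
  Removing \<open>v\<close> shortens the gap between \<open>x\<close> and \<open>y\<close> by one if \<open>v\<close> is between them and keeps it
  otherwise, so a gap becomes \<open>1\<close> from \<open>1\<close>, or from \<open>2\<close> with \<open>v\<close> in the middle. That middle
  position is expressed by two distances, because the king conditions speak of distances.
\<close>

lemma squeeze_far_iff:
  assumes "x \<noteq> v" "y \<noteq> v" "x \<noteq> y"
  shows "\<bar>int (squeeze v y) - int (squeeze v x)\<bar> > 1 \<longleftrightarrow>
    \<bar>int y - int x\<bar> \<noteq> 1 \<and>
    \<not> (\<bar>int y - int x\<bar> = 2 \<and> \<bar>int v - int x\<bar> = 1 \<and> \<bar>int v - int y\<bar> = 1)"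
  using assms unfolding squeeze_def by (auto simp: of_nat_diff)

lemma strict_mono_on_self_map_id:
  fixes h :: "nat \<Rightarrow> nat"
  assumes mono: "strict_mono_on {1..m} h" and into: "h ` {1..m} \<subseteq> {1..m}" and i: "i \<in> {1..m}"
  shows "h i = i"
proof (rule antisym)
  have less: "h a < h b" if "1 \<le> a" "a < b" "b \<le> m" for a b
    using mono that by (auto simp: strict_mono_on_def)
  have range: "1 \<le> h a \<and> h a \<le> m" if "1 \<le> a" "a \<le> m" for a
    using subsetD[OF into imageI, of a] that by simp
  have "1 \<le> i \<Longrightarrow> i \<le> m \<Longrightarrow> i \<le> h i" for i
  proof (induction i)
    case (Suc i)
    show ?case
    proof (cases "i = 0")
      case True
      then show ?thesis using range[of "Suc i"] Suc.prems by simp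
    next
      case False
      then show ?thesis using Suc less[of i "Suc i"] by simp
    qed
  qed simp
  then show "i \<le> h i" using i by simp
  have "i \<le> m \<Longrightarrow> 1 \<le> i \<Longrightarrow> h i \<le> i"
  proof (induction i rule: inc_induct)
    case base
    then show ?case using range[of m] by simp
  next
    case (step k)
    then show ?case using less[of k "Suc k"] by simp
  qed
  then show "h i \<le> i" using i by simp
qed

text \<open>
  Passing from the values of one permutation to those of the other is then a strictly increasing
  self-map of \<open>{1..m}\<close>.
\<close>

lemma order_isomorphic_permutations_eq:
  fixes \<pi> \<rho> :: "nat \<Rightarrow> nat"
  assumes "\<pi> permutes {1..m}" and \<rho>: "\<rho> permutes {1..m}"
    and iso: "\<And>i j. \<lbrakk>i \<in> {1..m}; j \<in> {1..m}\<rbrakk> \<Longrightarrow> \<pi> i < \<pi> j \<longleftrightarrow> \<rho> i < \<rho> j"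
  shows "\<pi> = \<rho>"
proof
  fix i
  let ?h = "\<lambda>x. \<pi> (inv \<rho> x)"
  have inv_in: "inv \<rho> x \<in> {1..m}" if "x \<in> {1..m}" for x
    using permutes_in_image[OF permutes_inv[OF \<rho>]] that by blast
  have "strict_mono_on {1..m} ?h"
    using inv_in iso permutes_inverses(1)[OF \<rho>] by (simp add: strict_mono_on_def)
  moreover have "?h ` {1..m} \<subseteq> {1..m}"
    using inv_in permutes_in_image[OF assms(1)] by blast
  ultimately have h: "?h x = x" if "x \<in> {1..m}" for x
    using strict_mono_on_self_map_id that by blast
  show "\<pi> i = \<rho> i"
  proof (cases "i \<in> {1..m}")
    case True
    then have "\<rho> i \<in> {1..m}" using permutes_in_image[OF \<rho>] by blast
    from h[OF this] show ?thesis using permutes_inverses(2)[OF \<rho>] by simp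
  next
    case False
    then show ?thesis using assms(1) \<rho> by (simp add: permutes_not_in)
  qed
qed

section \<open>Deleting an entry of a permutation\<close>

definition delete :: "nat \<Rightarrow> (nat \<Rightarrow> nat) \<Rightarrow> nat \<Rightarrow> nat \<Rightarrow> nat" where
  "delete n \<sigma> p i = (if i \<in> {1..n - 1} then squeeze (\<sigma> p) (\<sigma> (skip p i)) else i)"

lemma delete_less_iff:
  assumes "\<sigma> permutes {1..n}" "i \<in> {1..n - 1}" "j \<in> {1..n - 1}"
  shows "delete n \<sigma> p i < delete n \<sigma> p j \<longleftrightarrow> \<sigma> (skip p i) < \<sigma> (skip p j)"
proof -
  have "\<sigma> (skip p k) \<noteq> \<sigma> p" for k
    using permutes_inj[OF assms(1)] skip_neq by (metis injD)
  then show ?thesis using assms(2,3) by (simp add: delete_def squeeze_less_iff)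
qed

lemma delete_permutes:
  assumes \<sigma>: "\<sigma> permutes {1..n}" and p: "p \<in> {1..n}"
  shows "delete n \<sigma> p permutes {1..n - 1}"
proof (rule bij_imp_permutes)
  have "inj_on (delete n \<sigma> p) {1..n - 1}"
  proof (rule inj_onI)
    fix i j
    assume ij: "i \<in> {1..n - 1}" "j \<in> {1..n - 1}" and "delete n \<sigma> p i = delete n \<sigma> p j"
    then have "\<sigma> (skip p i) = \<sigma> (skip p j)"
      using delete_less_iff[OF \<sigma> ij] delete_less_iff[OF \<sigma> ij(2,1)]
      by (metis linorder_neqE_nat less_irrefl)
    then have "skip p i = skip p j" using permutes_inj[OF \<sigma>] by (simp add: inj_eq)
    then show "i = j" using skip_less_iff by (metis linorder_neqE_nat less_irrefl)
  qed
  moreover have "delete n \<sigma> p ` {1..n - 1} \<subseteq> {1..n - 1}"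
  proof (rule image_subsetI)
    fix i assume i: "i \<in> {1..n - 1}"
    have "\<sigma> (skip p i) \<in> {1..n}" "\<sigma> p \<in> {1..n}"
      using permutes_in_image[OF \<sigma>] skip_in[OF p i] p by blast+
    moreover have "\<sigma> (skip p i) \<noteq> \<sigma> p"
      using permutes_inj[OF \<sigma>] skip_neq by (metis injD)
    ultimately have "squeeze (\<sigma> p) (\<sigma> (skip p i)) \<in> {1..n - 1}" by (intro squeeze_in)
    then show "delete n \<sigma> p i \<in> {1..n - 1}" using i by (simp add: delete_def)
  qed
  ultimately show "bij_betw (delete n \<sigma> p) {1..n - 1} {1..n - 1}"
    by (simp add: bij_betw_def endo_inj_surj)
qed (auto simp: delete_def)

text \<open>
  An increasing list of \<open>n - 1\<close> positions omits exactly one position \<open>p\<close>, and is then \<open>skip p\<close>: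
  composing it with \<open>squeeze p\<close> gives a strictly increasing self-map of \<open>{1..n - 1}\<close>. Being
  order-isomorphic to the same subsequence, the pattern and the deletion at \<open>p\<close> coincide.
\<close>

lemma pattern_in_iff_delete:
  assumes \<sigma>: "\<sigma> permutes {1..n}" and n: "n \<ge> 1" and \<pi>: "\<pi> permutes {1..n - 1}"
  shows "pattern_in (n - 1) \<pi> n \<sigma> \<longleftrightarrow> (\<exists>p\<in>{1..n}. \<pi> = delete n \<sigma> p)"
proof
  assume "pattern_in (n - 1) \<pi> n \<sigma>"
  then obtain f where f_props: "strict_mono_on {1..n - 1} f \<and> f ` {1..n - 1} \<subseteq> {1..n} \<and>
      (\<forall>i\<in>{1..n - 1}. \<forall>j\<in>{1..n - 1}. \<pi> i < \<pi> j \<longleftrightarrow> \<sigma> (f i) < \<sigma> (f j))"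
    unfolding pattern_in_def by (rule exE)
  then have mono: "strict_mono_on {1..n - 1} f" and sub: "f ` {1..n - 1} \<subseteq> {1..n}"
    by (rule conjunct1, rule conjunct2[THEN conjunct1])
  have iso: "\<pi> i < \<pi> j \<longleftrightarrow> \<sigma> (f i) < \<sigma> (f j)" if "i \<in> {1..n - 1}" "j \<in> {1..n - 1}" for i j
    using f_props[THEN conjunct2, THEN conjunct2] that by simp
  have "card (f ` {1..n - 1}) < card {1..n}"
    using card_image_le[of "{1..n - 1}" f] n by simp
  then have "f ` {1..n - 1} \<noteq> {1..n}" by (metis less_irrefl)
  then obtain p where p: "p \<in> {1..n}" and miss: "p \<notin> f ` {1..n - 1}" using sub by blast
  have neq: "f i \<noteq> p" if "i \<in> {1..n - 1}" for i using miss that by blast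
  let ?h = "\<lambda>i. squeeze p (f i)"
  have "strict_mono_on {1..n - 1} ?h"
    using mono neq by (simp add: strict_mono_on_def squeeze_less_iff)
  moreover have "?h ` {1..n - 1} \<subseteq> {1..n - 1}"
  proof (rule image_subsetI)
    fix i assume "i \<in> {1..n - 1}"
    then have "f i \<in> {1..n}" "f i \<noteq> p" using sub miss by blast+
    then show "?h i \<in> {1..n - 1}" using p by (intro squeeze_in)
  qed
  ultimately have "squeeze p (f i) = i" if "i \<in> {1..n - 1}" for i
    using strict_mono_on_self_map_id that by blast
  then have f: "f i = skip p i" if "i \<in> {1..n - 1}" for i
    using skip_squeeze[OF neq] that by metis
  have "\<pi> = delete n \<sigma> p"
  proof (rule order_isomorphic_permutations_eq[OF \<pi> delete_permutes[OF \<sigma> p]])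
    fix i j assume ij: "i \<in> {1..n - 1}" "j \<in> {1..n - 1}"
    show "\<pi> i < \<pi> j \<longleftrightarrow> delete n \<sigma> p i < delete n \<sigma> p j"
      using iso[OF ij] f[OF ij(1)] f[OF ij(2)] delete_less_iff[OF \<sigma> ij] by simp
  qed
  then show "\<exists>p\<in>{1..n}. \<pi> = delete n \<sigma> p" using p by blast
next
  assume "\<exists>p\<in>{1..n}. \<pi> = delete n \<sigma> p"
  then obtain p where p: "p \<in> {1..n}" and \<pi>_eq: "\<pi> = delete n \<sigma> p" by blast
  show "pattern_in (n - 1) \<pi> n \<sigma>"
    unfolding pattern_in_def
  proof (intro exI conjI ballI)
    show "strict_mono_on {1..n - 1} (skip p)"
      by (simp add: strict_mono_on_def skip_less_iff)
    show "skip p ` {1..n - 1} \<subseteq> {1..n}"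
      using skip_in[OF p] by blast
  qed (simp only: \<pi>_eq delete_less_iff[OF \<sigma>])
qed

section \<open>Cyclic neighbours\<close>

definition cyc_succ :: "nat \<Rightarrow> nat \<Rightarrow> nat" where
  "cyc_succ n i = (if i = n then 1 else i + 1)"

lemma cyc_succ_in: "i \<in> {1..n} \<Longrightarrow> cyc_succ n i \<in> {1..n}"
  by (auto simp: cyc_succ_def)

text \<open>
  The condition on the last and first entry becomes an instance of the one on neighbours, so that
  no case distinction on the end of the interval is needed below.
\<close>

lemma CK_iff_cyc_succ:
  assumes "n \<ge> 2"
  shows "\<sigma> \<in> CK n \<longleftrightarrow> \<sigma> permutes {1..n} \<and>
    (\<forall>i\<in>{1..n}. \<bar>int (\<sigma> (cyc_succ n i)) - int (\<sigma> i)\<bar> > 1)"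
proof -
  have "{1..n} = insert n {1..n - 1}" using assms by auto
  then have "(\<forall>i\<in>{1..n}. \<bar>int (\<sigma> (cyc_succ n i)) - int (\<sigma> i)\<bar> > 1) \<longleftrightarrow>
      (\<forall>i\<in>{1..n - 1}. \<bar>int (\<sigma> (i + 1)) - int (\<sigma> i)\<bar> > 1) \<and> \<bar>int (\<sigma> 1) - int (\<sigma> n)\<bar> > 1"
    using assms by (auto simp: cyc_succ_def)
  then show ?thesis using assms by (simp add: CK_def Sym_def)
qed

lemma cyc_dist_commute: "cyc_dist n i j = cyc_dist n j i"
  by (simp add: cyc_dist_def abs_minus_commute)

lemma cyc_dist_pos: "\<lbrakk>i \<in> {1..n}; j \<in> {1..n}; i \<noteq> j\<rbrakk> \<Longrightarrow> cyc_dist n i j \<ge> 1"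
  unfolding cyc_dist_def by auto

lemma cyc_dist_1_cases:
  assumes "i \<in> {1..n}" "j \<in> {1..n}" "i < j" "cyc_dist n i j = 1"
  shows "j = cyc_succ n i \<or> i = cyc_succ n j"
  using assms unfolding cyc_dist_def cyc_succ_def by (auto simp: min_def split: if_splits)

lemma cyc_dist_2_cases:
  assumes "i \<in> {1..n}" "j \<in> {1..n}" "i < j" "cyc_dist n i j = 2"
  shows "j = cyc_succ n (cyc_succ n i) \<or> i = cyc_succ n (cyc_succ n j)"
  using assms unfolding cyc_dist_def cyc_succ_def by (auto simp: min_def split: if_splits)

lemma cyc_dist_cyc_succ: "i \<in> {1..n} \<Longrightarrow> cyc_dist n i (cyc_succ n i) \<le> 1"
  unfolding cyc_dist_def cyc_succ_def by auto

lemma cyc_dist_cyc_succ2: "i \<in> {1..n} \<Longrightarrow> cyc_dist n i (cyc_succ n (cyc_succ n i)) \<le> 2"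
  unfolding cyc_dist_def cyc_succ_def by auto

lemma cyc_succ_neq: "\<lbrakk>n \<ge> 3; i \<in> {1..n}\<rbrakk> \<Longrightarrow> cyc_succ n i \<noteq> i"
  by (auto simp: cyc_succ_def)

lemma cyc_succ2_neq: "\<lbrakk>n \<ge> 3; i \<in> {1..n}\<rbrakk> \<Longrightarrow> cyc_succ n (cyc_succ n i) \<noteq> i"
  by (auto simp: cyc_succ_def split: if_splits)

text \<open>
  After the deletion at \<open>p\<close>, the cyclic successor of a remaining position is its old one, unless
  that was \<open>p\<close>, in which case \<open>p\<close> is passed over.
\<close>

lemma skip_cyc_succ_squeeze:
  assumes "n \<ge> 3" "p \<in> {1..n}" "a \<in> {1..n}" "a \<noteq> p"
  shows "skip p (cyc_succ (n - 1) (squeeze p a)) =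
    (if cyc_succ n a = p then cyc_succ n p else cyc_succ n a)"
  using assms unfolding skip_def squeeze_def cyc_succ_def by auto

lemma delete_CK_iff:
  assumes \<sigma>: "\<sigma> permutes {1..n}" and n: "n \<ge> 3" and p: "p \<in> {1..n}"
  shows "delete n \<sigma> p \<in> CK (n - 1) \<longleftrightarrow>
    (\<forall>a\<in>{1..n} - {p}. let b = (if cyc_succ n a = p then cyc_succ n p else cyc_succ n a) in
       \<bar>int (squeeze (\<sigma> p) (\<sigma> b)) - int (squeeze (\<sigma> p) (\<sigma> a))\<bar> > 1)"
    (is "_ \<longleftrightarrow> (\<forall>a\<in>_. ?far a)")
proof -
  have step: "\<bar>int (delete n \<sigma> p (cyc_succ (n - 1) (squeeze p a))) - int (delete n \<sigma> p (squeeze p a))\<bar> > 1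
      \<longleftrightarrow> ?far a" if "a \<in> {1..n} - {p}" for a
  proof -
    have "squeeze p a \<in> {1..n - 1}" using squeeze_in p that by blast
    then have "delete n \<sigma> p (cyc_succ (n - 1) (squeeze p a)) =
          squeeze (\<sigma> p) (\<sigma> (skip p (cyc_succ (n - 1) (squeeze p a))))"
        "delete n \<sigma> p (squeeze p a) = squeeze (\<sigma> p) (\<sigma> (skip p (squeeze p a)))"
      using cyc_succ_in by (simp_all only: delete_def if_True)
    moreover have "skip p (squeeze p a) = a" using skip_squeeze that by blast
    moreover have "skip p (cyc_succ (n - 1) (squeeze p a)) =
        (if cyc_succ n a = p then cyc_succ n p else cyc_succ n a)"
      using skip_cyc_succ_squeeze[OF n p] that by blast
    ultimately show ?thesis by (simp only: Let_def)
  qed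
  have "squeeze p ` ({1..n} - {p}) = {1..n - 1}"
  proof
    show "squeeze p ` ({1..n} - {p}) \<subseteq> {1..n - 1}" using squeeze_in p by blast
    show "{1..n - 1} \<subseteq> squeeze p ` ({1..n} - {p})"
    proof
      fix i assume "i \<in> {1..n - 1}"
      then have "skip p i \<in> {1..n} - {p}" using skip_in[OF p] skip_neq by blast
      moreover have "i = squeeze p (skip p i)" by (simp add: skip_def squeeze_def)
      ultimately show "i \<in> squeeze p ` ({1..n} - {p})" by blast
    qed
  qed
  then have "delete n \<sigma> p \<in> CK (n - 1) \<longleftrightarrow> (\<forall>i\<in>squeeze p ` ({1..n} - {p}).
      \<bar>int (delete n \<sigma> p (cyc_succ (n - 1) i)) - int (delete n \<sigma> p i)\<bar> > 1)"
    using CK_iff_cyc_succ[of "n - 1"] n delete_permutes[OF \<sigma> p] by simp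
  then show ?thesis using step by (simp only: ball_simps(9)) blast
qed

section \<open>Deletions of cylindrical king permutations\<close>

lemma cbr_gt_iff:
  assumes "n \<ge> 2"
  shows "cbr n \<sigma> > c \<longleftrightarrow> (\<forall>i\<in>{1..n}. \<forall>j\<in>{1..n}. i \<noteq> j \<longrightarrow> cd n \<sigma> i j > c)"
proof -
  let ?D = "{cd n \<sigma> i j | i j. i \<in> {1..n} \<and> j \<in> {1..n} \<and> i \<noteq> j}"
  have "?D \<subseteq> (\<lambda>(i, j). cd n \<sigma> i j) ` ({1..n} \<times> {1..n})" by auto
  then have "finite ?D" by (rule finite_subset) simp
  moreover have "cd n \<sigma> 1 2 \<in> ?D" using assms by fastforce
  ultimately have "cbr n \<sigma> > c \<longleftrightarrow> (\<forall>d\<in>?D. d > c)"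
    unfolding cbr_def by (intro Min_gr_iff) auto
  then show ?thesis by blast
qed

text \<open>
  For \<open>p < q\<close>, position \<open>p\<close> holds the renumbered \<open>\<sigma> (p + 1)\<close> after the deletion at \<open>p\<close>, but the
  renumbered \<open>\<sigma> p\<close> after the one at \<open>q\<close>. Renumbering lowers a value by at most one, which cannot
  bridge the gap of at least two between these values.
\<close>

lemma inj_on_delete:
  assumes \<sigma>: "\<sigma> \<in> CK n" and n: "n \<ge> 2"
  shows "inj_on (delete n \<sigma>) {1..n}"
proof -
  have king: "\<bar>int (\<sigma> (i + 1)) - int (\<sigma> i)\<bar> > 1" if "i \<in> {1..n - 1}" for i
    using \<sigma> n that by (simp add: CK_def)
  have neq: "delete n \<sigma> p \<noteq> delete n \<sigma> q" if "1 \<le> p" "p < q" "q \<le> n" for p q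
  proof
    assume "delete n \<sigma> p = delete n \<sigma> q"
    then have "delete n \<sigma> p p = delete n \<sigma> q p" by simp
    then have "squeeze (\<sigma> p) (\<sigma> (p + 1)) = squeeze (\<sigma> q) (\<sigma> p)"
      using that by (simp add: delete_def skip_def split: if_splits)
    moreover have "p \<in> {1..n - 1}" using that by simp
    ultimately show False
      using king[of p] by (auto simp: squeeze_def split: if_splits)
  qed
  show ?thesis
    by (rule linorder_inj_onI) (use neq in auto)
qed

text \<open>
  Two entries of a cylindrical king permutation have cyclic distance at most \<open>3\<close> only if they are
  cyclic neighbours with value gap \<open>2\<close>, or have one position between them and value gap \<open>1\<close>. In
  the first case deleting the middle value, in the second deleting the middle position, leaves
  neighbours with value gap \<open>1\<close>.
\<close>

lemma all_deletions_CK_iff: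
  assumes \<sigma>: "\<sigma> \<in> CK n" and n: "n \<ge> 3"
  shows "(\<forall>p\<in>{1..n}. delete n \<sigma> p \<in> CK (n - 1)) \<longleftrightarrow> cbr n \<sigma> > 3"
proof -
  have perm: "\<sigma> permutes {1..n}"
    and king: "\<And>i. i \<in> {1..n} \<Longrightarrow> \<bar>int (\<sigma> (cyc_succ n i)) - int (\<sigma> i)\<bar> > 1"
    using CK_iff_cyc_succ[of n \<sigma>] \<sigma> n by auto
  have \<sigma>_eq: "\<sigma> i = \<sigma> j \<longleftrightarrow> i = j" for i j
    using permutes_inj[OF perm] by (rule inj_eq)
  show ?thesis
  proof
    assume cbr: "cbr n \<sigma> > 3"
    have cd_gt: "cd n \<sigma> i j > 3" if "i \<in> {1..n}" "j \<in> {1..n}" "i \<noteq> j" for i j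
      using cbr cbr_gt_iff[of n 3 \<sigma>] n that by simp
    show "\<forall>p\<in>{1..n}. delete n \<sigma> p \<in> CK (n - 1)"
    proof
      fix p assume p: "p \<in> {1..n}"
      have "\<bar>int (squeeze (\<sigma> p) (\<sigma> b)) - int (squeeze (\<sigma> p) (\<sigma> a))\<bar> > 1"
        if a: "a \<in> {1..n} - {p}"
          and b: "b = (if cyc_succ n a = p then cyc_succ n p else cyc_succ n a)" for a b
      proof (cases "cyc_succ n a = p")
        \<comment> \<open>The pair joined by the deletion: its gap could close from \<open>2\<close> only if \<open>\<sigma> p\<close> were at
          distance \<open>1\<close> from \<open>\<sigma> a\<close>, against the king condition at \<open>a\<close>.\<close>
        case True
        have a_in: "a \<in> {1..n}" using a by blast
        have b': "b = cyc_succ n (cyc_succ n a)" using b True by simp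
        have ab: "a \<noteq> b" "b \<noteq> p" "b \<in> {1..n}"
          using cyc_succ2_neq[OF n a_in] cyc_succ_neq[OF n p] cyc_succ_in p b' True by auto
        have "cyc_dist n a b \<le> 2" using cyc_dist_cyc_succ2[OF a_in] b' by simp
        then have "\<bar>int (\<sigma> b) - int (\<sigma> a)\<bar> \<noteq> 1"
          using cd_gt[OF a_in ab(3,1)] unfolding cd_def by linarith
        moreover have "\<bar>int (\<sigma> p) - int (\<sigma> a)\<bar> \<noteq> 1" using king[OF a_in] True by simp
        ultimately show ?thesis
          using squeeze_far_iff[of "\<sigma> a" "\<sigma> p" "\<sigma> b"] a ab \<sigma>_eq by auto
      next
        case False
        have a_in: "a \<in> {1..n}" using a by blast
        have b': "b = cyc_succ n a" using b False by simp
        have ab: "a \<noteq> b" "b \<noteq> p" "b \<in> {1..n}"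
          using cyc_succ_neq[OF n a_in] cyc_succ_in[OF a_in] b' False by auto
        have "cyc_dist n a b \<le> 1" using cyc_dist_cyc_succ[OF a_in] b' by simp
        then have "\<bar>int (\<sigma> b) - int (\<sigma> a)\<bar> > 2"
          using cd_gt[OF a_in ab(3,1)] unfolding cd_def by linarith
        then show ?thesis
          using squeeze_far_iff[of "\<sigma> a" "\<sigma> p" "\<sigma> b"] a ab \<sigma>_eq by auto
      qed
      then show "delete n \<sigma> p \<in> CK (n - 1)"
        using delete_CK_iff[OF perm n p] by (simp add: Let_def)
    qed
  next
    assume del: "\<forall>p\<in>{1..n}. delete n \<sigma> p \<in> CK (n - 1)"
    have far: "\<bar>int (squeeze (\<sigma> p) (\<sigma> b)) - int (squeeze (\<sigma> p) (\<sigma> a))\<bar> > 1"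
      if "p \<in> {1..n}" "a \<in> {1..n}" "a \<noteq> p"
        "b = (if cyc_succ n a = p then cyc_succ n p else cyc_succ n a)" for p a b
      using delete_CK_iff[OF perm n that(1)] del that by (simp add: Let_def)
    have adjacent: "\<bar>int (\<sigma> (cyc_succ n a)) - int (\<sigma> a)\<bar> \<noteq> 2" if a: "a \<in> {1..n}" for a
    proof
      let ?b = "cyc_succ n a"
      assume two: "\<bar>int (\<sigma> ?b) - int (\<sigma> a)\<bar> = 2"
      \<comment> \<open>The values differ by \<open>2\<close>, so the halved sum is exact and is the value between them.\<close>
      define v where "v = (\<sigma> a + \<sigma> ?b) div 2"
      have v: "\<bar>int v - int (\<sigma> a)\<bar> = 1" "\<bar>int v - int (\<sigma> ?b)\<bar> = 1"
        using two unfolding v_def by arith+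
      have \<sigma>_in: "\<sigma> a \<in> {1..n}" "\<sigma> ?b \<in> {1..n}"
        using permutes_in_image[OF perm] a cyc_succ_in[OF a] by blast+
      have "1 \<le> v \<and> v \<le> n" using \<sigma>_in two unfolding v_def atLeastAtMost_iff by arith
      then have "v \<in> {1..n}" by simp
      then obtain p where p: "p \<in> {1..n}" "\<sigma> p = v"
        using permutes_image[OF perm] by (metis imageE)
      have "a \<noteq> p" "?b \<noteq> p" using v p by auto
      then show False
        using far[OF p(1) a, of ?b] squeeze_far_iff[of "\<sigma> a" "\<sigma> p" "\<sigma> ?b"] two v p \<sigma>_eq
          cyc_succ_neq[OF n a] by auto
    qed
    have second: "\<bar>int (\<sigma> (cyc_succ n (cyc_succ n a))) - int (\<sigma> a)\<bar> \<noteq> 1"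
      if a: "a \<in> {1..n}" for a
    proof
      let ?p = "cyc_succ n a"
      let ?b = "cyc_succ n ?p"
      assume one: "\<bar>int (\<sigma> ?b) - int (\<sigma> a)\<bar> = 1"
      have p: "?p \<in> {1..n}" using cyc_succ_in[OF a] .
      have "a \<noteq> ?p" "?b \<noteq> ?p" "a \<noteq> ?b"
        using cyc_succ_neq[OF n a] cyc_succ_neq[OF n p] cyc_succ2_neq[OF n a] by auto
      then show False
        using far[OF p a, of ?b] squeeze_far_iff[of "\<sigma> a" "\<sigma> ?p" "\<sigma> ?b"] one \<sigma>_eq by auto
    qed
    have less: "cd n \<sigma> i j > 3" if ij: "i \<in> {1..n}" "j \<in> {1..n}" "i < j" for i j
    proof (rule ccontr)
      assume "\<not> cd n \<sigma> i j > 3"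
      moreover have "\<bar>int (\<sigma> j) - int (\<sigma> i)\<bar> \<ge> 1" using \<sigma>_eq[of i j] ij by linarith
      moreover have "cyc_dist n i j \<ge> 1" using cyc_dist_pos ij by simp
      ultimately consider
          "cyc_dist n i j = 1" "\<bar>int (\<sigma> j) - int (\<sigma> i)\<bar> \<le> 2"
        | "cyc_dist n i j = 2" "\<bar>int (\<sigma> j) - int (\<sigma> i)\<bar> = 1"
        unfolding cd_def by linarith
      then show False
      proof cases
        case 1
        from cyc_dist_1_cases[OF ij 1(1)] show False
          using king[OF ij(1)] king[OF ij(2)] adjacent[OF ij(1)] adjacent[OF ij(2)] 1(2)
          by auto
      next
        case 2
        from cyc_dist_2_cases[OF ij 2(1)] show False
          using second[OF ij(1)] second[OF ij(2)] 2(2) by auto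
      qed
    qed
    have "cd n \<sigma> i j > 3" if "i \<in> {1..n}" "j \<in> {1..n}" "i \<noteq> j" for i j
      using less[of i j] less[of j i] that
      by (cases "i < j") (auto simp: cd_def cyc_dist_commute abs_minus_commute)
    then show "cbr n \<sigma> > 3" using cbr_gt_iff[of n 3 \<sigma>] n by simp
  qed
qed

theorem proposition2p8:
  fixes n :: nat and \<sigma> :: "nat \<Rightarrow> nat"
  assumes "n \<ge> 2" and "\<sigma> \<in> CK n"
  shows "card {\<sigma>' \<in> CK (n - 1). pattern_in (n - 1) \<sigma>' n \<sigma>} = n \<longleftrightarrow> cbr n \<sigma> > 3"
proof -
  have perm: "\<sigma> permutes {1..n}" using CK_iff_cyc_succ[of n \<sigma>] assms by blast
  \<comment> \<open>\<open>CK 2\<close> is empty. From order \<open>3\<close> on, the deletions have order at least \<open>2\<close>, out of reach of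
    the convention for \<open>CK 1\<close>.\<close>
  have "n \<noteq> 2"
  proof
    assume n: "n = 2"
    then have "\<sigma> 1 \<in> {1..2}" "\<sigma> 2 \<in> {1..2}"
      using permutes_in_image[OF perm, of 1] permutes_in_image[OF perm, of 2] by auto
    then show False using assms(2) n by (auto simp: CK_def)
  qed
  then have n: "n \<ge> 3" using assms(1) by simp
  let ?D = "delete n \<sigma> ` {1..n}"
  have "\<pi> permutes {1..n - 1}" if "\<pi> \<in> CK (n - 1)" for \<pi>
    using CK_iff_cyc_succ[of "n - 1" \<pi>] n that by simp
  then have "{\<sigma>' \<in> CK (n - 1). pattern_in (n - 1) \<sigma>' n \<sigma>} = CK (n - 1) \<inter> ?D"
    using pattern_in_iff_delete[OF perm] n by auto
  moreover have "card ?D = n" using card_image[OF inj_on_delete[OF assms(2,1)]] by simp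
  then have "card (CK (n - 1) \<inter> ?D) = n \<longleftrightarrow> ?D \<subseteq> CK (n - 1)"
    using card_subset_eq[of ?D "CK (n - 1) \<inter> ?D"] by (auto simp: Int_absorb1)
  ultimately show ?thesis using all_deletions_CK_iff[OF assms(2) n] by auto
qed

end
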